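(* The windows of quasi-polynomials $\Psi_N$, $\Phi_N$ satisfy the differential systems $$\partial_x\Psi_N=-D_1^N(x)\Psi_N\quad(N\ge d_2+1),\qquad \partial_y\Phi_N=-D_2^N(y)\Phi_N\quad(N\ge d_1+1),$$ where $$D_1^N(x):=\gamma^N\mathbf a_{N-1}^{-1}+\beta_0^N+\sum_{j=1}^{d_1}\beta_j^N\,\mathbf a_{N+j-1}\mathbf a_{N+j-2}\cdots\mathbf a_N\in\mathfrak{gl}_{d_2+1}[x],$$ $$D_2^N(y):=\gamma^N\mathbf b_{N-1}^{-1}+\alpha_0^N+\sum_{j=1}^{d_2}\alpha_j^N\,\mathbf b_{N+j-1}\mathbf b_{N+j-2}\cdots\mathbf b_N\in\mathfrak{gl}_{d_1+1}[y].$$ These systems, taken together for all $N$, are equivalent to the relations $$\partial_x\psi_n=-\gamma(n-1)\psi_{n-1}-\sum_{j=0}^{d_1}\beta_j(n+j)\psi_{n+j},\qquad \partial_y\phi_n=-\gamma(n-1)\phi_{n-1}-\sum_{j=0}^{d_2}\alpha_j(n+j)\phi_{n+j}$$ when the recursion relations $\mathbf a_N\Psi_N=\Psi_{N+1}$, $\mathbf b_N\Phi_N=\Phi_{N+1}$ (and hence $\Psi_{N+j}=\mathbf a_{N+j-1}\cdots\mathbf a_N\Psi_N$, $\Phi_{N+j}=\mathbf b_{N+j-1}\cdots\mathbf b_N\Phi_N$) are taken into account.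
   Context: Fix integers $d_1,d_2\ge1$ and $V_1(x)=\sum_{K=1}^{d_1+1}\frac{u_K}{K}x^K$, $V_2(y)=\sum_{J=1}^{d_2+1}\frac{v_J}{J}y^J$ with $u_{d_1+1}\ne0$, $v_{d_2+1}\ne0$, and contours $\Gamma_x,\Gamma_y$ such that all integrals below converge and integrations by parts produce no boundary terms. Assume there are monic polynomials $\pi_n,\sigma_n$ of degree $n$ ($n\ge0$) with $\int_{\Gamma_x}\int_{\Gamma_y}\pi_n(x)\sigma_m(y)e^{-V_1(x)-V_2(y)+xy}\,dy\,dx=h_n\delta_{nm}$, $h_n\neq0$. Fix $\sqrt{h_n}$ and put $\psi_n(x)=\pi_n(x)e^{-V_1(x)}/\sqrt{h_n}$, $\phi_n(y)=\sigma_n(y)e^{-V_2(y)}/\sqrt{h_n}$ (the quasi-polynomials). There are unique numbers $\alpha_j(n)$ ($0\le j\le d_2$), $\beta_j(n)$ ($0\le j\le d_1$), zero for $n<j$, such that with $\gamma(n)=\sqrt{h_{n+1}}/\sqrt{h_n}$ (terms with negative index omitted): $x\psi_n=\gamma(n)\psi_{n+1}+\sum_{j=0}^{d_2}\alpha_j(n)\psi_{n-j}$, $\partial_x\psi_n=-\gamma(n-1)\psi_{n-1}-\sum_{j=0}^{d_1}\beta_j(n+j)\psi_{n+j}$, $y\phi_n=\gamma(n)\phi_{n+1}+\sum_{j=0}^{d_1}\beta_j(n)\phi_{n-j}$, $\partial_y\phi_n=-\gamma(n-1)\phi_{n-1}-\sum_{j=0}^{d_2}\alpha_j(n+j)\phi_{n+j}$.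 Moreover $\alpha_{d_2}(n)\ne0$ for $n\ge d_2$ and $\beta_{d_1}(n)\ne0$ for $n\ge d_1$. Windows: $\Psi_N=[\psi_{N-d_2},\dots,\psi_N]^t$ ($N\ge d_2$), $\Phi_N=[\phi_{N-d_1},\dots,\phi_N]^t$ ($N\ge d_1$). $\mathbf a_N(x)$ ($N\ge d_2$) is the $(d_2+1)\times(d_2+1)$ matrix with $1$'s on the first superdiagonal, last row $\frac1{\gamma(N)}(-\alpha_{d_2}(N),\dots,-\alpha_1(N),x-\alpha_0(N))$, other entries $0$. $\mathbf b_N(y)$ ($N\ge d_1$) is the $(d_1+1)\times(d_1+1)$ matrix with $1$'s on the first superdiagonal, last row $\frac1{\gamma(N)}(-\beta_{d_1}(N),\dots,-\beta_1(N),y-\beta_0(N))$, other entries $0$. Both are invertible. Diagonal matrices: $\beta_j^N=\mathrm{diag}(\beta_j(N+j-d_2),\dots,\beta_j(N+j))$, $\alpha_j^N=\mathrm{diag}(\alpha_j(N+j-d_1),\dots,\alpha_j(N+j))$; $\gamma^N$ denotes $\mathrm{diag}(\gamma(N-d_2-1),\dots,\gamma(N-1))$ in $D_1^N$ and $\mathrm{diag}(\gamma(N-d_1-1),\dots,\gamma(N-1))$ in $D_2^N$. *)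

theory Defs
  imports
    "HOL-Analysis.Analysis"
    "HOL-Computational_Algebra.Polynomial"
    "Jordan_Normal_Form.Matrix"
    "Jordan_Normal_Form.Gauss_Jordan_Elimination"
begin

unbundle no vec_syntax

text \<open>A contour is a finite chain of weighted curves, each parametrized by the whole real line
  (curves running to infinity are allowed). A single curve g is the list [(1, g)].\<close>

type_synonym contour = "(complex \<times> (real \<Rightarrow> complex)) list"

definition valid_contour :: "contour \<Rightarrow> bool" where
  "valid_contour \<Gamma> \<longleftrightarrow>
     (\<forall>(c, g) \<in> set \<Gamma>. \<forall>a b. g piecewise_C1_differentiable_on {a..b})"

definition contour_int :: "contour \<Rightarrow> (complex \<Rightarrow> complex) \<Rightarrow> complex" where
  "contour_int \<Gamma> F =
     (\<Sum>(c, g) \<leftarrow> \<Gamma>. c * (LBINT t. F (g t) * vector_derivative g (at t)))"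

definition contour_int2 :: "contour \<Rightarrow> contour \<Rightarrow> (complex \<Rightarrow> complex \<Rightarrow> complex) \<Rightarrow> complex" where
  "contour_int2 \<Gamma>x \<Gamma>y F = contour_int \<Gamma>x (\<lambda>x. contour_int \<Gamma>y (\<lambda>y. F x y))"

definition contour_integrable2 ::
    "contour \<Rightarrow> contour \<Rightarrow> (complex \<Rightarrow> complex \<Rightarrow> complex) \<Rightarrow> bool" where
  "contour_integrable2 \<Gamma>x \<Gamma>y F \<longleftrightarrow>
     (\<forall>(c, g) \<in> set \<Gamma>x. \<forall>(c', k) \<in> set \<Gamma>y.
        integrable (lborel \<Otimes>\<^sub>M lborel)
          (\<lambda>(s, t). F (g s) (k t) * vector_derivative g (at s) * vector_derivative k (at t)))"

definition potential :: "nat \<Rightarrow> (nat \<Rightarrow> complex) \<Rightarrow> complex \<Rightarrow> complex" where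
  "potential d u x = (\<Sum>K = 1..d+1. u K / of_nat K * x ^ K)"

definition weighted ::
    "(complex \<Rightarrow> complex) \<Rightarrow> (complex \<Rightarrow> complex) \<Rightarrow> complex poly \<Rightarrow> complex poly
      \<Rightarrow> complex \<Rightarrow> complex \<Rightarrow> complex" where
  "weighted V1 V2 p q x y = poly p x * poly q y * exp (- V1 x - V2 y + x * y)"

text \<open>All integrals of polynomials against the weight converge absolutely.\<close>

definition weight_converges ::
    "contour \<Rightarrow> contour \<Rightarrow> (complex \<Rightarrow> complex) \<Rightarrow> (complex \<Rightarrow> complex) \<Rightarrow> bool" where
  "weight_converges \<Gamma>x \<Gamma>y V1 V2 \<longleftrightarrow>
     (\<forall>p q. contour_integrable2 \<Gamma>x \<Gamma>y (weighted V1 V2 p q))"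

text \<open>Absence of boundary terms: total derivatives, in either variable, integrate to zero.\<close>

definition no_boundary_terms ::
    "contour \<Rightarrow> contour \<Rightarrow> (complex \<Rightarrow> complex) \<Rightarrow> (complex \<Rightarrow> complex) \<Rightarrow> bool" where
  "no_boundary_terms \<Gamma>x \<Gamma>y V1 V2 \<longleftrightarrow>
     (\<forall>p q. contour_int2 \<Gamma>x \<Gamma>y (\<lambda>x y. deriv (\<lambda>z. weighted V1 V2 p q z y) x) = 0 \<and>
            contour_int2 \<Gamma>x \<Gamma>y (\<lambda>x y. deriv (\<lambda>z. weighted V1 V2 p q x z) y) = 0)"

definition monic_seq :: "(nat \<Rightarrow> complex poly) \<Rightarrow> bool" where
  "monic_seq p \<longleftrightarrow> (\<forall>n. degree (p n) = n \<and> lead_coeff (p n) = 1)"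

definition biorthogonal ::
    "contour \<Rightarrow> contour \<Rightarrow> (complex \<Rightarrow> complex) \<Rightarrow> (complex \<Rightarrow> complex)
      \<Rightarrow> (nat \<Rightarrow> complex poly) \<Rightarrow> (nat \<Rightarrow> complex poly) \<Rightarrow> (nat \<Rightarrow> complex) \<Rightarrow> bool" where
  "biorthogonal \<Gamma>x \<Gamma>y V1 V2 p q h \<longleftrightarrow>
     (\<forall>n m. contour_int2 \<Gamma>x \<Gamma>y (weighted V1 V2 (p n) (q m)) = (if n = m then h n else 0))"

text \<open>The argument \<open>r\<close> is the chosen sequence of square roots of the norms.\<close>

definition quasi_poly ::
    "(complex \<Rightarrow> complex) \<Rightarrow> (nat \<Rightarrow> complex poly) \<Rightarrow> (nat \<Rightarrow> complex)
      \<Rightarrow> nat \<Rightarrow> complex \<Rightarrow> complex" where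
  "quasi_poly V p r n x = poly (p n) x * exp (- V x) / r n"

text \<open>The two scalar relations, for an arbitrary sequence of functions \<open>f\<close>; the coefficient written
  \<open>\<alpha>\<^sub>j(n)\<close> on paper is \<open>\<alpha> j n\<close>. Terms with negative index are omitted. The two
  families \<open>\<psi>\<close> and \<open>\<phi>\<close> are obtained by exchanging \<open>\<alpha>\<close> and \<open>\<beta>\<close> and the degrees.\<close>

definition mult_rel ::
    "nat \<Rightarrow> (nat \<Rightarrow> complex) \<Rightarrow> (nat \<Rightarrow> nat \<Rightarrow> complex) \<Rightarrow> (nat \<Rightarrow> complex \<Rightarrow> complex)
      \<Rightarrow> nat \<Rightarrow> bool" where
  "mult_rel d \<gamma> \<alpha> f n \<longleftrightarrow>
     (\<forall>x. x * f n x = \<gamma> n * f (n + 1) x + (\<Sum>j | j \<le> d \<and> j \<le> n. \<alpha> j n * f (n - j) x))"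

definition deriv_rel ::
    "nat \<Rightarrow> (nat \<Rightarrow> complex) \<Rightarrow> (nat \<Rightarrow> nat \<Rightarrow> complex) \<Rightarrow> (nat \<Rightarrow> complex \<Rightarrow> complex)
      \<Rightarrow> nat \<Rightarrow> bool" where
  "deriv_rel e \<gamma> \<beta> f n \<longleftrightarrow>
     (\<forall>x. (f n has_field_derivative
            (- (if n = 0 then 0 else \<gamma> (n - 1) * f (n - 1) x)
             - (\<Sum>j = 0..e. \<beta> j (n + j) * f (n + j) x))) (at x))"

definition recursion_coeffs ::
    "nat \<Rightarrow> nat \<Rightarrow> (nat \<Rightarrow> complex) \<Rightarrow> (nat \<Rightarrow> complex \<Rightarrow> complex) \<Rightarrow> (nat \<Rightarrow> complex \<Rightarrow> complex)
      \<Rightarrow> (nat \<Rightarrow> nat \<Rightarrow> complex) \<Rightarrow> (nat \<Rightarrow> nat \<Rightarrow> complex) \<Rightarrow> bool" where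
  "recursion_coeffs d1 d2 \<gamma> \<psi> \<phi> \<alpha> \<beta> \<longleftrightarrow>
     (\<forall>j n. n < j \<longrightarrow> j \<le> d2 \<longrightarrow> \<alpha> j n = 0) \<and>
     (\<forall>j n. n < j \<longrightarrow> j \<le> d1 \<longrightarrow> \<beta> j n = 0) \<and>
     (\<forall>n. mult_rel d2 \<gamma> \<alpha> \<psi> n) \<and> (\<forall>n. deriv_rel d1 \<gamma> \<beta> \<psi> n) \<and>
     (\<forall>n. mult_rel d1 \<gamma> \<beta> \<phi> n) \<and> (\<forall>n. deriv_rel d2 \<gamma> \<alpha> \<phi> n)"

text \<open>Windows and matrices have size \<open>d + 1\<close> and indices from \<open>0\<close>; \<open>N \<ge> d\<close>
  (respectively \<open>N \<ge> d + 1\<close>) is needed for the natural-number subtractions to be genuine.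
  With \<open>(d, e) = (d2, d1)\<close> one gets \<open>\<Psi>\<^sub>N\<close>, \<open>a\<^sub>N\<close>, \<open>D\<^sub>1\<^sup>N\<close>,
  and with \<open>(d, e) = (d1, d2)\<close> and \<open>\<alpha>\<close>, \<open>\<beta>\<close> exchanged \<open>\<Phi>\<^sub>N\<close>,
  \<open>b\<^sub>N\<close>, \<open>D\<^sub>2\<^sup>N\<close>.\<close>

definition window :: "nat \<Rightarrow> (nat \<Rightarrow> complex \<Rightarrow> complex) \<Rightarrow> nat \<Rightarrow> complex \<Rightarrow> complex Matrix.vec" where
  "window d f N x = Matrix.vec (d + 1) (\<lambda>i. f (N - d + i) x)"

definition ladder ::
    "nat \<Rightarrow> (nat \<Rightarrow> complex) \<Rightarrow> (nat \<Rightarrow> nat \<Rightarrow> complex) \<Rightarrow> nat \<Rightarrow> complex \<Rightarrow> complex Matrix.mat" where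
  "ladder d \<gamma> \<alpha> N x = Matrix.mat (d + 1) (d + 1)
     (\<lambda>(i, j). if i < d then (if j = i + 1 then 1 else 0)
               else ((if j = d then x else 0) - \<alpha> (d - j) N) / \<gamma> N)"

fun ladder_prod ::
    "nat \<Rightarrow> (nat \<Rightarrow> complex) \<Rightarrow> (nat \<Rightarrow> nat \<Rightarrow> complex) \<Rightarrow> nat \<Rightarrow> complex \<Rightarrow> nat
      \<Rightarrow> complex Matrix.mat" where
  "ladder_prod d \<gamma> \<alpha> N x 0 = 1\<^sub>m (d + 1)"
| "ladder_prod d \<gamma> \<alpha> N x (Suc j) = ladder d \<gamma> \<alpha> (N + j) x * ladder_prod d \<gamma> \<alpha> N x j"

definition gamma_diag :: "nat \<Rightarrow> (nat \<Rightarrow> complex) \<Rightarrow> nat \<Rightarrow> complex Matrix.mat" where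
  "gamma_diag d \<gamma> N = mat_diag (d + 1) (\<lambda>i. \<gamma> (N - d - 1 + i))"

definition coeff_diag ::
    "nat \<Rightarrow> (nat \<Rightarrow> nat \<Rightarrow> complex) \<Rightarrow> nat \<Rightarrow> nat \<Rightarrow> complex Matrix.mat" where
  "coeff_diag d \<beta> j N = mat_diag (d + 1) (\<lambda>i. \<beta> j (N + j - d + i))"

definition Dmat ::
    "nat \<Rightarrow> nat \<Rightarrow> (nat \<Rightarrow> complex) \<Rightarrow> (nat \<Rightarrow> nat \<Rightarrow> complex) \<Rightarrow> (nat \<Rightarrow> nat \<Rightarrow> complex)
      \<Rightarrow> nat \<Rightarrow> complex \<Rightarrow> complex Matrix.mat" where
  "Dmat d e \<gamma> \<alpha> \<beta> N x =
     foldl (+)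
       (gamma_diag d \<gamma> N * the (mat_inverse (ladder d \<gamma> \<alpha> (N - 1) x)) + coeff_diag d \<beta> 0 N)
       (map (\<lambda>j. coeff_diag d \<beta> j N * ladder_prod d \<gamma> \<alpha> N x j) [1..<e + 1])"

definition polynomial_mat :: "nat \<Rightarrow> (complex \<Rightarrow> complex Matrix.mat) \<Rightarrow> bool" where
  "polynomial_mat n A \<longleftrightarrow>
     (\<exists>P \<in> carrier_mat n n. \<forall>x. A x = map_mat (\<lambda>p. poly p x) P)"

text \<open>The linear system stating that the window has derivative \<open>- D\<^sub>N(x)\<close> times itself,
  with the derivative of a vector taken entrywise.\<close>

definition diff_system ::
    "nat \<Rightarrow> (nat \<Rightarrow> complex \<Rightarrow> complex Matrix.mat) \<Rightarrow> (nat \<Rightarrow> complex \<Rightarrow> complex) \<Rightarrow> nat \<Rightarrow> bool" where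
  "diff_system d D f N \<longleftrightarrow>
     (\<forall>x. \<forall>i < d + 1.
        ((\<lambda>z. window d f N z $ i) has_field_derivative
          ((- D N x *\<^sub>v window d f N x) $ i)) (at x))"

definition window_rec ::
    "nat \<Rightarrow> (nat \<Rightarrow> complex) \<Rightarrow> (nat \<Rightarrow> nat \<Rightarrow> complex) \<Rightarrow> (nat \<Rightarrow> complex \<Rightarrow> complex) \<Rightarrow> bool" where
  "window_rec d \<gamma> \<alpha> f \<longleftrightarrow>
     (\<forall>N \<ge> d. \<forall>x. ladder d \<gamma> \<alpha> N x *\<^sub>v window d f N x = window d f (N + 1) x)"

end

theory Submission
  imports Defs "Jordan_Normal_Form.Determinant"
begin

text \<open>Applied to the window, the inverse ladder matrix shifts it back by one step and a product of
  ladder matrices shifts it forward, so row \<open>i\<close> of the system at \<open>N\<close> is the scalar differential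
  relation at \<open>n = N - d + i\<close>, and these indices cover exactly \<open>n \<ge> 1\<close>. Invertibility needs
  \<open>\<alpha>\<^sub>d(n) \<noteq> 0\<close>, which comes from comparing leading coefficients in the differential relation for the
  other family; no integral enters.

  The relation at \<open>n = 0\<close> is not a row of any system. The multiplication recursion determines a
  solution from its initial function, so a solution is \<open>f n = g * \<psi> n\<close> with \<open>g = f 0 / \<psi> 0\<close>. The relation
  at \<open>n = 1\<close>, valid for both \<open>f\<close> and \<open>\<psi>\<close>, says that \<open>g' = 0\<close> away from the only zero of
  \<open>\<psi> 1\<close>, and that \<open>g\<close> is continuous there because the zero is simple. Hence \<open>g\<close> is constant, and
  \<open>f\<close> inherits the relation at \<open>0\<close> from \<open>\<psi>\<close>.\<close>

section \<open>Inverse of the ladder matrix\<close>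

text \<open>The top row is the recursion solved for its oldest term: \<open>f (N - d)\<close> in
  terms of the window at \<open>N + 1\<close>, where column \<open>d\<close> belongs to
  \<open>f (N + 1)\<close> and column \<open>d - 1\<close> to \<open>f N\<close>. The other rows
  only shift.\<close>

definition ladder_inv ::
    "nat \<Rightarrow> (nat \<Rightarrow> complex) \<Rightarrow> (nat \<Rightarrow> nat \<Rightarrow> complex) \<Rightarrow> nat \<Rightarrow> complex \<Rightarrow> complex Matrix.mat" where
  "ladder_inv d \<gamma> \<alpha> N x = Matrix.mat (d + 1) (d + 1)
     (\<lambda>(i, j). if i = 0
        then (if j = d then - \<gamma> N else (if j + 1 = d then x else 0) - \<alpha> (d - (j + 1)) N) / \<alpha> d N
        else (if i = j + 1 then 1 else 0))"

lemma ladder_carrier: "ladder d \<gamma> \<alpha> N x \<in> carrier_mat (d + 1) (d + 1)"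
  by (simp add: ladder_def)

lemma ladder_inv_carrier: "ladder_inv d \<gamma> \<alpha> N x \<in> carrier_mat (d + 1) (d + 1)"
  by (simp add: ladder_inv_def)

lemma window_carrier: "window d f N x \<in> carrier_vec (d + 1)"
  by (simp add: window_def)

declare ladder_carrier [simplified, simp] ladder_inv_carrier [simplified, simp]
  window_carrier [simplified, simp]

lemma window_index [simp]: "i < d + 1 \<Longrightarrow> window d f N x $ i = f (N - d + i) x"
  by (simp add: window_def)

lemma mult_mat_vec_index:
  assumes "A \<in> carrier_mat n m" "w \<in> carrier_vec m" "i < n"
  shows "(A *\<^sub>v w) $ i = (\<Sum>j<m. A $$ (i, j) * w $ j)"
  using assms by (auto simp: scalar_prod_def atLeast0LessThan intro!: sum.cong)

lemma mult_mat_index: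
  assumes "A \<in> carrier_mat n m" "B \<in> carrier_mat m l" "i < n" "j < l"
  shows "(A * B) $$ (i, j) = (\<Sum>k<m. A $$ (i, k) * B $$ (k, j))"
  using assms by (auto simp: scalar_prod_def atLeast0LessThan intro!: sum.cong)

text \<open>The condition \<open>d \<ge> 1\<close> excludes the single entry
  \<open>(x - \<alpha> 0 N) / \<gamma> N\<close>, which vanishes at
  \<open>x = \<alpha> 0 N\<close>.\<close>

lemma ladder_mult_inv:
  assumes "\<gamma> N \<noteq> 0" "\<alpha> d N \<noteq> 0" "d \<ge> 1"
  shows "ladder d \<gamma> \<alpha> N x * ladder_inv d \<gamma> \<alpha> N x = 1\<^sub>m (d + 1)" (is "?A * ?B = _")
proof (rule eq_matI)
  fix i j assume "i < dim_row (1\<^sub>m (d + 1) :: complex Matrix.mat)"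
    "j < dim_col (1\<^sub>m (d + 1) :: complex Matrix.mat)"
  then have i: "i < d + 1" and j: "j < d + 1" by auto
  have prod: "(?A * ?B) $$ (i, j) = (\<Sum>k<d+1. ?A $$ (i, k) * ?B $$ (k, j))"
    by (rule mult_mat_index) (use i j in auto)
  show "(?A * ?B) $$ (i, j) = 1\<^sub>m (d + 1) $$ (i, j)"
  proof (cases "i < d")
    case True
    have "(\<Sum>k<d+1. ?A $$ (i, k) * ?B $$ (k, j))
        = (\<Sum>k<d+1. if k = i + 1 then ?B $$ (i + 1, j) else 0)"
      using True by (intro sum.cong) (auto simp: ladder_def)
    also have "\<dots> = ?B $$ (i + 1, j)"
      using True by (simp add: sum.delta)
    finally show ?thesis
      using True i j prod by (auto simp: ladder_inv_def)
  next
    case False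
    with i have [simp]: "i = d" by simp
    define c where "c k = (if k = d then x else 0) - \<alpha> (d - k) N" for k
    have A: "?A $$ (d, k) = c k / \<gamma> N" if "k < d + 1" for k
      using that by (simp add: ladder_def c_def)
    \<comment> \<open>Below its top row the inverse has unit rows, so apart from
      \<open>k = 0\<close> at most the term in row \<open>j + 1\<close> survives.\<close>
    have "(\<Sum>k<d+1. ?A $$ (i, k) * ?B $$ (k, j))
        = ?A $$ (d, 0) * ?B $$ (0, j) + (\<Sum>k<d. ?A $$ (d, Suc k) * ?B $$ (Suc k, j))"
      by (simp only: Suc_eq_plus1[symmetric] sum.lessThan_Suc_shift \<open>i = d\<close>)
    also have "(\<Sum>k<d. ?A $$ (d, Suc k) * ?B $$ (Suc k, j))
        = (\<Sum>k<d. if k = j then c (Suc j) / \<gamma> N else 0)"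
      using j by (intro sum.cong) (auto simp: A ladder_inv_def)
    also have "\<dots> = (if j < d then c (Suc j) / \<gamma> N else 0)"
      by (simp add: sum.delta)
    \<comment> \<open>Here \<open>c 0 = - \<alpha> d N\<close> because \<open>d \<ge> 1\<close>,
      which cancels the denominator of the top row.\<close>
    also have "?A $$ (d, 0) * ?B $$ (0, j) = (if j = d then 1 else - c (Suc j) / \<gamma> N)"
      using assms j by (auto simp: A ladder_inv_def c_def field_simps)
    finally show ?thesis
      using prod j by auto
  qed
qed (auto simp: ladder_def ladder_inv_def)

lemma inv_mult_ladder:
  assumes "\<gamma> N \<noteq> 0" "\<alpha> d N \<noteq> 0" "d \<ge> 1"
  shows "ladder_inv d \<gamma> \<alpha> N x * ladder d \<gamma> \<alpha> N x = 1\<^sub>m (d + 1)"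
  by (rule mat_mult_left_right_inverse[OF _ _ ladder_mult_inv]) (use assms in auto)

lemma invertible_ladder:
  assumes "\<gamma> N \<noteq> 0" "\<alpha> d N \<noteq> 0" "d \<ge> 1"
  shows "invertible_mat (ladder d \<gamma> \<alpha> N x)"
  unfolding invertible_mat_def inverts_mat_def
  using ladder_mult_inv[where \<gamma> = \<gamma> and \<alpha> = \<alpha> and N = N, OF assms]
    inv_mult_ladder[where \<gamma> = \<gamma> and \<alpha> = \<alpha> and N = N, OF assms]
    ladder_carrier ladder_inv_carrier
  by (metis carrier_matD square_mat.elims(3))

text \<open>\<open>mat_inverse\<close> is the result of an elimination and may be
  \<open>None\<close>. Uniqueness of inverses identifies it with any explicit one, so that
  \<open>the\<close> in \<open>Dmat\<close> yields a genuine inverse.\<close>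

lemma mat_inverse_eqI:
  fixes A :: "'a :: field Matrix.mat"
  assumes A: "A \<in> carrier_mat n n" and B: "B \<in> carrier_mat n n"
    and AB: "A * B = 1\<^sub>m n" and BA: "B * A = 1\<^sub>m n"
  shows "mat_inverse A = Some B"
proof (cases "mat_inverse A")
  case None
  then have "A \<notin> Units (ring_mat TYPE('a) n n)"
    by (rule mat_inverse(1)[OF A])
  with A B AB BA show ?thesis
    by (auto simp: Units_def ring_mat_def)
next
  case (Some C)
  then have C: "A * C = 1\<^sub>m n" "C \<in> carrier_mat n n"
    using mat_inverse(2)[OF A] by auto
  have "C = (B * A) * C" using C BA by simp
  also have "\<dots> = B * (A * C)" by (rule assoc_mult_mat[OF B A C(2)])
  also have "\<dots> = B" using C B by simp
  finally show ?thesis using Some by simp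
qed

lemma mat_inverse_ladder:
  assumes "\<gamma> N \<noteq> 0" "\<alpha> d N \<noteq> 0" "d \<ge> 1"
  shows "mat_inverse (ladder d \<gamma> \<alpha> N x) = Some (ladder_inv d \<gamma> \<alpha> N x)"
  by (intro mat_inverse_eqI[of _ "d + 1"] ladder_mult_inv inv_mult_ladder
      ladder_carrier ladder_inv_carrier assms)

section \<open>Window recursion and its iterates\<close>

lemma ladder_prod_carrier: "ladder_prod d \<gamma> \<alpha> N x j \<in> carrier_mat (d + 1) (d + 1)"
proof (induction j)
  case (Suc j)
  then show ?case by (simp only: ladder_prod.simps) (rule mult_carrier_mat[OF ladder_carrier])
qed simp

declare ladder_prod_carrier [simplified, simp]

lemma window_ladder_prod:
  assumes "window_rec d \<gamma> \<alpha> f" "N \<ge> d"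
  shows "window d f (N + j) x = ladder_prod d \<gamma> \<alpha> N x j *\<^sub>v window d f N x"
proof (induction j)
  case 0
  then show ?case by (simp add: one_mult_mat_vec[OF window_carrier])
next
  case (Suc j)
  have "window d f (N + Suc j) x = ladder d \<gamma> \<alpha> (N + j) x *\<^sub>v window d f (N + j) x"
    using assms by (simp add: window_rec_def)
  with Suc show ?case
    by (simp only: ladder_prod.simps
        assoc_mult_mat_vec[OF ladder_carrier ladder_prod_carrier window_carrier])
qed

text \<open>All rows but the last are shifts and hold for any sequence; the last one is the
  multiplication relation at \<open>N\<close> solved for \<open>f (N + 1)\<close>.\<close>

lemma window_rec_of_mult_rel:
  assumes \<gamma>: "\<And>n. \<gamma> n \<noteq> 0" and mult: "\<And>n. mult_rel d \<gamma> \<alpha> f n"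
  shows "window_rec d \<gamma> \<alpha> f"
  unfolding window_rec_def
proof (intro allI impI eq_vecI)
  fix N x i assume N: "d \<le> N" and "i < dim_vec (window d f (N + 1) x)"
  then have i: "i < d + 1" by (simp add: window_def)
  have row: "(ladder d \<gamma> \<alpha> N x *\<^sub>v window d f N x) $ i
      = (\<Sum>j<d+1. ladder d \<gamma> \<alpha> N x $$ (i, j) * f (N - d + j) x)"
    using mult_mat_vec_index[OF ladder_carrier window_carrier i] by simp
  show "(ladder d \<gamma> \<alpha> N x *\<^sub>v window d f N x) $ i = window d f (N + 1) x $ i"
  proof (cases "i < d")
    case True
    have "(\<Sum>j<d+1. ladder d \<gamma> \<alpha> N x $$ (i, j) * f (N - d + j) x)
        = (\<Sum>j<d+1. if j = i + 1 then f (N - d + (i + 1)) x else 0)"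
      using True by (intro sum.cong) (auto simp: ladder_def)
    also have "\<dots> = f (N - d + (i + 1)) x" using True by (simp add: sum.delta)
    finally show ?thesis using row i N by (simp add: algebra_simps Suc_diff_le)
  next
    case False
    with i have [simp]: "i = d" by simp
    have "(\<Sum>j<d+1. ladder d \<gamma> \<alpha> N x $$ (i, j) * f (N - d + j) x)
        = (\<Sum>j<d+1. ((if j = d then x * f N x else 0) - \<alpha> (d - j) N * f (N - d + j) x) / \<gamma> N)"
      using N by (intro sum.cong) (auto simp: ladder_def field_simps)
    also have "\<dots> = (x * f N x - (\<Sum>j<d+1. \<alpha> (d - j) N * f (N - d + j) x)) / \<gamma> N"
      by (simp add: sum_subtractf sum.delta flip: sum_divide_distrib del: sum.lessThan_Suc)
    \<comment> \<open>Windows list the oldest function first, hence the reversal \<open>j\<close> to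
      \<open>d - j\<close>. As \<open>N \<ge> d\<close>, no term is omitted on the right.\<close>
    also have "(\<Sum>j<d+1. \<alpha> (d - j) N * f (N - d + j) x)
        = (\<Sum>j | j \<le> d \<and> j \<le> N. \<alpha> j N * f (N - j) x)"
      using N by (intro sum.reindex_bij_witness[of _ "\<lambda>j. d - j" "\<lambda>j. d - j"]) auto
    also have "(x * f N x - \<dots>) / \<gamma> N = f (N + 1) x"
      using mult[of N] \<gamma>[of N] by (auto simp: mult_rel_def)
    finally show ?thesis using row N by (simp add: Suc_diff_le)
  qed
qed (auto simp: ladder_def window_def)

section \<open>Rows of the differential system\<close>

lemma foldl_add_mat_carrier:
  assumes "M \<in> carrier_mat n m" "\<And>j. j \<in> set js \<Longrightarrow> F j \<in> carrier_mat n m"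
  shows "foldl (+) M (map F js) \<in> carrier_mat n m"
  using assms by (induction js arbitrary: M) auto

lemma add_mat_mult_vec_index:
  fixes A :: "'a :: comm_ring_1 Matrix.mat"
  assumes "A \<in> carrier_mat n m" "B \<in> carrier_mat n m" "w \<in> carrier_vec m" "i < n"
  shows "((A + B) *\<^sub>v w) $ i = (A *\<^sub>v w) $ i + (B *\<^sub>v w) $ i"
proof -
  have "B *\<^sub>v w \<in> carrier_vec n" using assms by (simp add: mult_mat_vec_carrier)
  then show ?thesis
    using assms(4) unfolding add_mult_distrib_mat_vec[OF assms(1-3)]
    by (intro index_add_vec(1)) (auto dest: carrier_vecD)
qed

text \<open>Matrices of all sizes share one type, so \<open>Dmat\<close> adds its terms by a fold
  from a starting matrix; distributing the product is an induction on the list.\<close>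

lemma foldl_add_mat_mult_vec:
  fixes M :: "'a :: comm_ring_1 Matrix.mat"
  assumes "M \<in> carrier_mat n m" "\<And>j. j \<in> set js \<Longrightarrow> F j \<in> carrier_mat n m"
    "w \<in> carrier_vec m" "i < n"
  shows "(foldl (+) M (map F js) *\<^sub>v w) $ i = (M *\<^sub>v w) $ i + (\<Sum>j\<leftarrow>js. (F j *\<^sub>v w) $ i)"
  using assms
proof (induction js arbitrary: M)
  case (Cons a js)
  then have a: "F a \<in> carrier_mat n m" by simp
  have "((M + F a) *\<^sub>v w) $ i = (M *\<^sub>v w) $ i + (F a *\<^sub>v w) $ i"
    using Cons.prems a by (intro add_mat_mult_vec_index) auto
  with Cons.IH[of "M + F a"] Cons.prems a show ?case
    by (simp add: add.assoc del: index_mult_mat_vec)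
qed simp

lemma mat_diag_mult_vec_index:
  assumes "w \<in> carrier_vec n" "i < n"
  shows "(mat_diag n c *\<^sub>v w) $ i = c i * w $ i"
proof -
  have "(mat_diag n c *\<^sub>v w) $ i = (\<Sum>j<n. if j = i then c i * w $ i else 0)"
    unfolding mult_mat_vec_index[OF mat_diag_dim assms]
    using assms by (intro sum.cong) (auto simp: mat_diag_def)
  with assms show ?thesis by (simp add: sum.delta)
qed

lemma Dmat_summands_carrier:
  "gamma_diag d \<gamma> N * ladder_inv d \<gamma> \<alpha> M x + coeff_diag d \<beta> 0 N \<in> carrier_mat (d + 1) (d + 1)"
  "coeff_diag d \<beta> j N * ladder_prod d \<gamma> \<alpha> N x j \<in> carrier_mat (d + 1) (d + 1)"
  unfolding gamma_diag_def coeff_diag_def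
  by (meson add_carrier_mat mult_carrier_mat mat_diag_dim ladder_inv_carrier ladder_prod_carrier)+

lemma Dmat_eq:
  assumes "\<And>n. \<gamma> n \<noteq> 0" "\<forall>n\<ge>d. \<alpha> d n \<noteq> 0" "d \<ge> 1" "N \<ge> d + 1"
  shows "Dmat d e \<gamma> \<alpha> \<beta> N x = foldl (+)
     (gamma_diag d \<gamma> N * ladder_inv d \<gamma> \<alpha> (N - 1) x + coeff_diag d \<beta> 0 N)
     (map (\<lambda>j. coeff_diag d \<beta> j N * ladder_prod d \<gamma> \<alpha> N x j) [1..<e + 1])"
proof -
  have "mat_inverse (ladder d \<gamma> \<alpha> (N - 1) x) = Some (ladder_inv d \<gamma> \<alpha> (N - 1) x)"
    using assms by (intro mat_inverse_ladder) auto
  then show ?thesis unfolding Dmat_def by simp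
qed

lemma Dmat_carrier:
  assumes "\<And>n. \<gamma> n \<noteq> 0" "\<forall>n\<ge>d. \<alpha> d n \<noteq> 0" "d \<ge> 1" "N \<ge> d + 1"
  shows "Dmat d e \<gamma> \<alpha> \<beta> N x \<in> carrier_mat (d + 1) (d + 1)"
  unfolding Dmat_eq[where \<gamma> = \<gamma> and \<alpha> = \<alpha> and N = N, OF assms]
  by (intro foldl_add_mat_carrier Dmat_summands_carrier)

text \<open>Each term of \<open>Dmat\<close> first moves the window, to \<open>N - 1\<close> or to
  \<open>N + j\<close>, and then scales its rows by a diagonal matrix. With
  \<open>n = N - d + i\<close>, row \<open>i\<close> is thus the scalar expression at
  \<open>n\<close>; \<open>N \<ge> d + 1\<close> makes \<open>n - 1\<close> a true
  subtraction.\<close>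

lemma Dmat_mult_window:
  assumes \<gamma>: "\<And>n. \<gamma> n \<noteq> 0" and \<alpha>: "\<forall>n\<ge>d. \<alpha> d n \<noteq> 0" and d: "d \<ge> 1"
    and N: "N \<ge> d + 1" and rec: "window_rec d \<gamma> \<alpha> f" and i: "i < d + 1"
  shows "(Dmat d e \<gamma> \<alpha> \<beta> N x *\<^sub>v window d f N x) $ i
    = \<gamma> (N - d + i - 1) * f (N - d + i - 1) x
      + (\<Sum>j = 0..e. \<beta> j (N - d + i + j) * f (N - d + i + j) x)"
proof -
  let ?L = "ladder d \<gamma> \<alpha> (N - 1) x" and ?B = "ladder_inv d \<gamma> \<alpha> (N - 1) x"
  let ?w = "window d f N x"
  note ass = assoc_mult_mat_vec[of _ "d + 1" "d + 1" _ "d + 1"]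
  \<comment> \<open>The window at \<open>N\<close> is the ladder at \<open>N - 1\<close> applied to
    the previous window, as \<open>N - 1 \<ge> d\<close>; the inverse undoes this.\<close>
  have shift: "?B *\<^sub>v ?w = window d f (N - 1) x"
  proof -
    have "?w = ?L *\<^sub>v window d f (N - 1) x"
      using rec N by (auto simp: window_rec_def dest!: spec[of _ "N - 1"])
    then have "?B *\<^sub>v ?w = (?B * ?L) *\<^sub>v window d f (N - 1) x"
      by (simp add: ass)
    also have "?B * ?L = 1\<^sub>m (d + 1)"
      using \<gamma> \<alpha> d N by (intro inv_mult_ladder) auto
    finally show ?thesis by (simp add: one_mult_mat_vec[OF window_carrier])
  qed
  have diag: "(mat_diag (d + 1) c * A *\<^sub>v ?w) $ i = c i * (A *\<^sub>v ?w) $ i"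
    if "A \<in> carrier_mat (d + 1) (d + 1)" for c A
    using that i ass[OF mat_diag_dim that window_carrier]
    by (simp add: mat_diag_mult_vec_index mult_mat_vec_carrier[OF that window_carrier])
  have "(Dmat d e \<gamma> \<alpha> \<beta> N x *\<^sub>v ?w) $ i
      = ((gamma_diag d \<gamma> N * ?B + coeff_diag d \<beta> 0 N) *\<^sub>v ?w) $ i
        + (\<Sum>j\<leftarrow>[1..<e + 1]. (coeff_diag d \<beta> j N * ladder_prod d \<gamma> \<alpha> N x j *\<^sub>v ?w) $ i)"
    unfolding Dmat_eq[where \<gamma> = \<gamma> and \<alpha> = \<alpha> and N = N, OF \<gamma> \<alpha> d N]
    by (rule foldl_add_mat_mult_vec[OF Dmat_summands_carrier(1) _ window_carrier i])
       (rule Dmat_summands_carrier(2))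
  also have "((gamma_diag d \<gamma> N * ?B + coeff_diag d \<beta> 0 N) *\<^sub>v ?w) $ i
      = (gamma_diag d \<gamma> N * ?B *\<^sub>v ?w) $ i + (coeff_diag d \<beta> 0 N *\<^sub>v ?w) $ i"
    using i unfolding gamma_diag_def coeff_diag_def
    by (intro add_mat_mult_vec_index[OF _ mat_diag_dim window_carrier]
        mult_carrier_mat[OF mat_diag_dim ladder_inv_carrier])
  also have "(gamma_diag d \<gamma> N * ?B *\<^sub>v ?w) $ i = \<gamma> (N - d + i - 1) * f (N - d + i - 1) x"
    using N i unfolding gamma_diag_def diag[OF ladder_inv_carrier] shift by simp
  also have "(coeff_diag d \<beta> 0 N *\<^sub>v ?w) $ i = \<beta> 0 (N - d + i) * f (N - d + i) x"
    using i unfolding coeff_diag_def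
    by (subst mat_diag_mult_vec_index[OF window_carrier]) auto
  also have "(\<Sum>j\<leftarrow>[1..<e + 1]. (coeff_diag d \<beta> j N * ladder_prod d \<gamma> \<alpha> N x j *\<^sub>v ?w) $ i)
      = (\<Sum>j\<leftarrow>[1..<e + 1]. \<beta> j (N - d + i + j) * f (N - d + i + j) x)"
  proof (intro arg_cong[of _ _ sum_list] map_cong refl)
    fix j
    have "(coeff_diag d \<beta> j N * ladder_prod d \<gamma> \<alpha> N x j *\<^sub>v ?w) $ i
        = \<beta> j (N + j - d + i) * window d f (N + j) x $ i"
      using N window_ladder_prod[OF rec, of N j x] unfolding coeff_diag_def
      by (simp only: diag[OF ladder_prod_carrier])
    also have "N + j - d + i = N - d + i + j" using N by simp
    finally show "(coeff_diag d \<beta> j N * ladder_prod d \<gamma> \<alpha> N x j *\<^sub>v ?w) $ i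
        = \<beta> j (N - d + i + j) * f (N - d + i + j) x"
      using i N by (simp add: algebra_simps)
  qed
  also have "\<dots> = (\<Sum>j = 1..e. \<beta> j (N - d + i + j) * f (N - d + i + j) x)"
    by (simp add: sum_list_distinct_conv_sum_set atLeastLessThanSuc_atLeastAtMost del: upt_Suc)
  \<comment> \<open>The term with \<open>j = 0\<close>, kept apart in \<open>Dmat\<close>, rejoins
    the sum.\<close>
  finally show ?thesis
    by (simp add: sum.atLeast_Suc_atMost[of 0])
qed

text \<open>The index \<open>N - d + i\<close> is at least 1, so the exceptional case
  \<open>n = 0\<close> of \<open>deriv_rel\<close> does not occur and the two right-hand sides agree
  row by row.\<close>

lemma diff_system_Dmat_iff:
  assumes \<gamma>: "\<And>n. \<gamma> n \<noteq> 0" and \<alpha>: "\<forall>n\<ge>d. \<alpha> d n \<noteq> 0" and d: "d \<ge> 1"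
    and N: "N \<ge> d + 1" and rec: "window_rec d \<gamma> \<alpha> f"
  shows "diff_system d (Dmat d e \<gamma> \<alpha> \<beta>) f N \<longleftrightarrow> (\<forall>i < d + 1. deriv_rel e \<gamma> \<beta> f (N - d + i))"
proof -
  have "(- Dmat d e \<gamma> \<alpha> \<beta> N x *\<^sub>v window d f N x) $ i
      = - (if N - d + i = 0 then 0 else \<gamma> (N - d + i - 1) * f (N - d + i - 1) x)
        - (\<Sum>j = 0..e. \<beta> j (N - d + i + j) * f (N - d + i + j) x)" if i: "i < d + 1" for i x
  proof -
    note D = Dmat_carrier[where \<gamma> = \<gamma> and \<alpha> = \<alpha> and N = N, OF \<gamma> \<alpha> d N, of e \<beta> x]
    have "- Dmat d e \<gamma> \<alpha> \<beta> N x *\<^sub>v window d f N x = - (Dmat d e \<gamma> \<alpha> \<beta> N x *\<^sub>v window d f N x)"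
      using D by (intro uminus_mult_mat_vec) (auto simp: window_def)
    then have "(- Dmat d e \<gamma> \<alpha> \<beta> N x *\<^sub>v window d f N x) $ i
        = - ((Dmat d e \<gamma> \<alpha> \<beta> N x *\<^sub>v window d f N x) $ i)"
      using D i by simp
    with Dmat_mult_window[where \<gamma> = \<gamma> and \<alpha> = \<alpha> and N = N, OF \<gamma> \<alpha> d N rec i] N show ?thesis by simp
  qed
  then show ?thesis
    unfolding diff_system_def deriv_rel_def by auto
qed

text \<open>Windows overlap, but each \<open>n \<ge> 1\<close> is the first row of exactly one of
  them, the window at \<open>N = n + d\<close>.\<close>

lemma diff_system_all_iff:
  assumes \<gamma>: "\<And>n. \<gamma> n \<noteq> 0" and \<alpha>: "\<forall>n\<ge>d. \<alpha> d n \<noteq> 0" and d: "d \<ge> 1"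
    and rec: "window_rec d \<gamma> \<alpha> f"
  shows "(\<forall>N \<ge> d + 1. diff_system d (Dmat d e \<gamma> \<alpha> \<beta>) f N) \<longleftrightarrow> (\<forall>n \<ge> 1. deriv_rel e \<gamma> \<beta> f n)"
proof -
  have "(\<forall>N \<ge> d + 1. diff_system d (Dmat d e \<gamma> \<alpha> \<beta>) f N)
      \<longleftrightarrow> (\<forall>N \<ge> d + 1. \<forall>i < d + 1. deriv_rel e \<gamma> \<beta> f (N - d + i))"
    using diff_system_Dmat_iff[where \<gamma> = \<gamma> and \<alpha> = \<alpha>, OF \<gamma> \<alpha> d _ rec] by blast
  also have "\<dots> \<longleftrightarrow> (\<forall>n \<ge> 1. deriv_rel e \<gamma> \<beta> f n)"
  proof (intro iffI allI impI)
    fix n :: nat assume *: "\<forall>N \<ge> d + 1. \<forall>i < d + 1. deriv_rel e \<gamma> \<beta> f (N - d + i)" and "n \<ge> 1"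
    then show "deriv_rel e \<gamma> \<beta> f n" using *[rule_format, of "n + d" 0] by simp
  qed simp
  finally show ?thesis .
qed

section \<open>Polynomial dependence on the variable\<close>

text \<open>Choosing a polynomial for each entry assembles the matrix of polynomials. The entrywise
  form is convenient for sums and products.\<close>

lemma polynomial_mat_iff:
  "polynomial_mat n A \<longleftrightarrow> (\<forall>x. A x \<in> carrier_mat n n) \<and>
     (\<forall>i<n. \<forall>j<n. \<exists>P. \<forall>x. A x $$ (i, j) = poly P x)" (is "?l \<longleftrightarrow> ?c \<and> ?r")
proof
  assume ?l
  then obtain P where P: "P \<in> carrier_mat n n" "\<And>x. A x = map_mat (\<lambda>p. poly p x) P"
    by (auto simp: polynomial_mat_def)
  then have "A x $$ (i, j) = poly (P $$ (i, j)) x" if "i < n" "j < n" for i j x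
    using that by simp
  with P show "?c \<and> ?r" by auto
next
  assume r: "?c \<and> ?r"
  then obtain P where P: "\<And>i j x. i < n \<Longrightarrow> j < n \<Longrightarrow> A x $$ (i, j) = poly (P i j) x"
    by metis
  show ?l unfolding polynomial_mat_def
  proof (intro bexI allI)
    show "A x = map_mat (\<lambda>p. poly p x) (Matrix.mat n n (\<lambda>(i, j). P i j))" for x
      using r P by (intro eq_matI) auto
  qed simp
qed

lemma polynomial_mat_carrier: "polynomial_mat n A \<Longrightarrow> A x \<in> carrier_mat n n"
  by (simp add: polynomial_mat_iff)

lemma polynomial_mat_entry:
  "polynomial_mat n A \<Longrightarrow> i < n \<Longrightarrow> j < n \<Longrightarrow> \<exists>P. \<forall>x. A x $$ (i, j) = poly P x"
  unfolding polynomial_mat_iff by blast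

lemma polynomial_mat_const:
  assumes "M \<in> carrier_mat n n"
  shows "polynomial_mat n (\<lambda>_. M)"
proof -
  have "M $$ (i, j) = poly [:M $$ (i, j):] x" for i j x by simp
  with assms show ?thesis unfolding polynomial_mat_iff by blast
qed

lemma polynomial_mat_add:
  assumes A: "polynomial_mat n A" and B: "polynomial_mat n B"
  shows "polynomial_mat n (\<lambda>x. A x + B x)"
  unfolding polynomial_mat_iff
proof (intro conjI allI impI)
  fix i j assume ij: "i < n" "j < n"
  obtain P Q where "\<And>x. A x $$ (i, j) = poly P x" "\<And>x. B x $$ (i, j) = poly Q x"
    using polynomial_mat_entry[OF A ij] polynomial_mat_entry[OF B ij] by blast
  then have "(A x + B x) $$ (i, j) = poly (P + Q) x" for x
    using polynomial_mat_carrier[OF B, of x] ij by simp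
  then show "\<exists>P. \<forall>x. (A x + B x) $$ (i, j) = poly P x" by blast
qed (use A B polynomial_mat_carrier in auto)

lemma polynomial_mat_mult:
  assumes A: "polynomial_mat n A" and B: "polynomial_mat n B"
  shows "polynomial_mat n (\<lambda>x. A x * B x)"
  unfolding polynomial_mat_iff
proof (intro conjI allI impI)
  fix i j assume ij: "i < n" "j < n"
  have "\<forall>k\<in>{..<n}. \<exists>P. \<forall>x. A x $$ (i, k) = poly P x"
    using polynomial_mat_entry[OF A ij(1)] by blast
  from bchoice[OF this] obtain P where P: "\<And>k x. k < n \<Longrightarrow> A x $$ (i, k) = poly (P k) x"
    by blast
  have "\<forall>k\<in>{..<n}. \<exists>Q. \<forall>x. B x $$ (k, j) = poly Q x"
    using polynomial_mat_entry[OF B _ ij(2)] by blast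
  from bchoice[OF this] obtain Q where Q: "\<And>k x. k < n \<Longrightarrow> B x $$ (k, j) = poly (Q k) x"
    by blast
  have "(A x * B x) $$ (i, j) = poly (\<Sum>k<n. P k * Q k) x" for x
    unfolding mult_mat_index[OF polynomial_mat_carrier[OF A] polynomial_mat_carrier[OF B] ij]
    by (simp add: P Q poly_sum)
  then show "\<exists>P. \<forall>x. (A x * B x) $$ (i, j) = poly P x" by blast
next
  show "A x * B x \<in> carrier_mat n n" for x
    using A B polynomial_mat_carrier mult_carrier_mat by blast
qed

lemma polynomial_mat_foldl:
  assumes "polynomial_mat n M" "\<And>j. j \<in> set js \<Longrightarrow> polynomial_mat n (F j)"
  shows "polynomial_mat n (\<lambda>x. foldl (+) (M x) (map (\<lambda>j. F j x) js))"
  using assms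
proof (induction js arbitrary: M)
  case (Cons a js)
  then show ?case using Cons.IH[of "\<lambda>x. M x + F a x"] by (simp add: polynomial_mat_add)
qed simp

lemma polynomial_mat_ladder: "polynomial_mat (d + 1) (ladder d \<gamma> \<alpha> N)"
  unfolding polynomial_mat_iff
proof (intro conjI allI impI)
  fix i j assume "i < d + 1" "j < d + 1"
  then have "ladder d \<gamma> \<alpha> N x $$ (i, j) = poly
     (if i < d then (if j = i + 1 then 1 else 0)
      else Polynomial.smult (1 / \<gamma> N) ((if j = d then [:0, 1:] else 0) - [:\<alpha> (d - j) N:])) x" for x
    by (auto simp: ladder_def)
  then show "\<exists>P. \<forall>x. ladder d \<gamma> \<alpha> N x $$ (i, j) = poly P x" by blast
qed simp

text \<open>The only denominator is \<open>\<alpha> d N\<close>, which is independent of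
  \<open>x\<close>. This reflects that for \<open>d \<ge> 1\<close> the determinant of the ladder
  matrix is constant in \<open>x\<close>.\<close>

lemma polynomial_mat_ladder_inv: "polynomial_mat (d + 1) (ladder_inv d \<gamma> \<alpha> N)"
  unfolding polynomial_mat_iff
proof (intro conjI allI impI)
  fix i j assume "i < d + 1" "j < d + 1"
  then have "ladder_inv d \<gamma> \<alpha> N x $$ (i, j) = poly
     (if i = 0 then Polynomial.smult (1 / \<alpha> d N) (if j = d then [:- \<gamma> N:]
        else (if j + 1 = d then [:0, 1:] else 0) - [:\<alpha> (d - (j + 1)) N:])
      else (if i = j + 1 then 1 else 0)) x" for x
    by (auto simp: ladder_inv_def)
  then show "\<exists>P. \<forall>x. ladder_inv d \<gamma> \<alpha> N x $$ (i, j) = poly P x" by blast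
qed simp

lemma polynomial_mat_ladder_prod: "polynomial_mat (d + 1) (\<lambda>x. ladder_prod d \<gamma> \<alpha> N x j)"
proof (induction j)
  case 0
  show ?case by (simp only: ladder_prod.simps) (rule polynomial_mat_const, simp)
next
  case (Suc j)
  then show ?case
    by (simp only: ladder_prod.simps) (rule polynomial_mat_mult[OF polynomial_mat_ladder])
qed

lemma polynomial_mat_Dmat:
  assumes "\<And>n. \<gamma> n \<noteq> 0" "\<forall>n\<ge>d. \<alpha> d n \<noteq> 0" "d \<ge> 1" "N \<ge> d + 1"
  shows "polynomial_mat (d + 1) (Dmat d e \<gamma> \<alpha> \<beta> N)"
proof -
  have eq: "Dmat d e \<gamma> \<alpha> \<beta> N = (\<lambda>x. foldl (+)
     (gamma_diag d \<gamma> N * ladder_inv d \<gamma> \<alpha> (N - 1) x + coeff_diag d \<beta> 0 N)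
     (map (\<lambda>j. coeff_diag d \<beta> j N * ladder_prod d \<gamma> \<alpha> N x j) [1..<e + 1]))"
    by (intro ext Dmat_eq[where \<gamma> = \<gamma> and \<alpha> = \<alpha> and N = N, OF assms])
  show ?thesis unfolding eq
    by (intro polynomial_mat_foldl polynomial_mat_add polynomial_mat_mult
        polynomial_mat_ladder_inv polynomial_mat_ladder_prod polynomial_mat_const)
       (auto simp: gamma_diag_def coeff_diag_def)
qed

section \<open>Nonvanishing of the extreme recursion coefficients\<close>

text \<open>The relation at \<open>n\<close> compares polynomials of degree \<open>n + e\<close>; their leading coefficients give
  \<open>\<beta>\<^sub>e(n + e)\<close>.\<close>

lemma leading_coeff_nonzero:
  assumes r: "\<And>n. r n \<noteq> 0" and p: "monic_seq p" and e: "e \<ge> 1" and u: "u (e + 1) \<noteq> 0"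
    and deriv: "\<And>n. deriv_rel e \<gamma> \<beta> (quasi_poly (potential e u) p r) n" and n: "n \<ge> e"
  shows "\<beta> e n \<noteq> 0"
proof -
  \<comment> \<open>The relation is read at \<open>m\<close> so that its term of highest degree has
    index \<open>m + e = n\<close>.\<close>
  define m where "m = n - e"
  have n_eq: "n = m + e" using n by (simp add: m_def)
  define W where "W = (\<Sum>K = 1..e+1. monom (u K / of_nat K) K)"
  have V: "potential e u x = poly W x" for x
    by (simp add: potential_def W_def poly_sum poly_monom del: sum.cl_ivl_Suc)
  have deg: "degree (p k) = k" and lc: "coeff (p k) k = 1" for k
    using p unfolding monic_seq_def by metis+
  \<comment> \<open>After division by the exponential factor, \<open>R\<close> is the actual
    derivative of the quasi-polynomial and \<open>S\<close> the right-hand side of the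
    relation.\<close>
  define R where "R = Polynomial.smult (1 / r m) (pderiv (p m) - pderiv W * p m)"
  define S where "S = - (if m = 0 then 0 else Polynomial.smult (\<gamma> (m - 1) / r (m - 1)) (p (m - 1)))
      - (\<Sum>j = 0..e. Polynomial.smult (\<beta> j (m + j) / r (m + j)) (p (m + j)))"
  have "poly R x = poly S x" for x
  proof -
    have "(quasi_poly (potential e u) p r m has_field_derivative
        poly R x * exp (- poly W x)) (at x)"
      unfolding quasi_poly_def[abs_def] V using r[of m]
      by (auto intro!: derivative_eq_intros simp: R_def field_simps)
    moreover have "(quasi_poly (potential e u) p r m has_field_derivative
        poly S x * exp (- poly W x)) (at x)"
    proof -
      have "- (if m = 0 then 0 else \<gamma> (m - 1) * quasi_poly (potential e u) p r (m - 1) x)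
         - (\<Sum>j = 0..e. \<beta> j (m + j) * quasi_poly (potential e u) p r (m + j) x)
         = poly S x * exp (- poly W x)"
        by (simp add: S_def quasi_poly_def V poly_sum left_diff_distrib sum_distrib_right
            mult.assoc)
      with deriv[of m] show ?thesis unfolding deriv_rel_def by metis
    qed
    ultimately have "poly R x * exp (- poly W x) = poly S x * exp (- poly W x)"
      by (rule DERIV_unique)
    then show ?thesis by simp
  qed
  then have "R = S" by (simp flip: poly_eq_poly_eq_iff add: fun_eq_iff)
  then have "coeff R n = coeff S n" by simp
  moreover have "coeff R n = - u (e + 1) / r m"
  proof -
    have W: "coeff W k = (if 1 \<le> k \<and> k \<le> e + 1 then u k / of_nat k else 0)" for k
      by (simp add: W_def coeff_sum del: sum.cl_ivl_Suc)
    have "coeff (pderiv W * p m) (e + m)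
        = (\<Sum>i\<le>e + m. coeff (pderiv W) i * coeff (p m) (e + m - i))"
      by (rule coeff_mult)
    \<comment> \<open>For \<open>i < e\<close> the index \<open>e + m - i\<close> exceeds the degree
      of \<open>p m\<close>; for \<open>i > e\<close> it is \<open>pderiv W\<close>, of degree at
      most \<open>e\<close>, that contributes zero.\<close>
    also have "\<dots> = (\<Sum>i\<le>e + m. if i = e then coeff (pderiv W) e else 0)"
    proof (intro sum.cong refl)
      fix i
      consider "i < e" | "i = e" | "i > e" by linarith
      then show "coeff (pderiv W) i * coeff (p m) (e + m - i)
          = (if i = e then coeff (pderiv W) e else 0)"
        by cases (simp_all add: lc coeff_eq_0 deg coeff_pderiv W)
    qed
    also have "\<dots> = coeff (pderiv W) e" by (simp add: sum.delta)
    also have "\<dots> = u (e + 1)"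
      using of_nat_neq_0[of e, where 'a = complex] by (simp add: coeff_pderiv W lc del: of_nat_Suc)
    finally have "coeff (pderiv W * p m) (e + m) = u (e + 1)" .
    moreover have "coeff (pderiv (p m)) (e + m) = 0"
      using deg[of m] e by (simp add: coeff_pderiv coeff_eq_0)
    ultimately show ?thesis by (simp add: R_def n_eq add.commute)
  qed
  moreover have "coeff S n = - \<beta> e n / r n"
  proof -
    have "(\<Sum>j = 0..e. \<beta> j (m + j) / r (m + j) * coeff (p (m + j)) n)
        = (\<Sum>j = 0..e. if j = e then \<beta> e n / r n else 0)"
      by (intro sum.cong) (auto simp: n_eq lc deg coeff_eq_0)
    then show ?thesis
      using e by (simp add: S_def coeff_sum n_eq coeff_eq_0 deg)
  qed
  \<comment> \<open>Equating the coefficients gives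
    \<open>\<beta> e n = u (e + 1) * r n / r m\<close>.\<close>
  ultimately show ?thesis using u r[of m] r[of n] by (auto simp: field_simps)
qed

section \<open>The relation at index zero\<close>

text \<open>At a zero of \<open>k\<close> the quotient of difference quotients shows that \<open>g\<close> is continuous.\<close>

lemma constant_factor:
  fixes g k k' :: "complex \<Rightarrow> complex"
  assumes k: "\<And>x. (k has_field_derivative k' x) (at x)"
    and gk: "\<And>x. ((\<lambda>x. g x * k x) has_field_derivative g x * k' x) (at x)"
    and fin: "finite {x. k x = 0}" and simple: "\<And>x. k x = 0 \<Longrightarrow> k' x \<noteq> 0"
  shows "\<exists>c. \<forall>x. g x = c"
proof -
  \<comment> \<open>The quotient rule for \<open>g * k / k\<close> has numerator
    \<open>g * k' * k - g * k * k' = 0\<close>.\<close>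
  have zero: "(g has_field_derivative 0) (at x)" if "k x \<noteq> 0" for x
  proof -
    have "((\<lambda>x. g x * k x / k x) has_field_derivative 0) (at x)"
      by (rule DERIV_cong[OF DERIV_divide[OF gk k that]]) simp
    moreover have "open {z. k z \<noteq> 0}"
      using DERIV_isCont[OF k]
      by (intro open_Collect_neq) (auto simp: continuous_on_eq_continuous_at)
    ultimately show ?thesis
      by (rule has_field_derivative_transform_within_open) (use that in auto)
  qed
  have "isCont g x" for x
  proof (cases "k x = 0")
    case True
    \<comment> \<open>Since \<open>k x = 0\<close>, this quotient is \<open>g z\<close> at every
      nearby \<open>z\<close> other than \<open>x\<close>, the zeros of \<open>k\<close> being
      isolated; its limit is \<open>g x\<close> because \<open>k' x \<noteq> 0\<close>.\<close>
    have quot: "((\<lambda>z. ((g z * k z - g x * k x) / (z - x)) / ((k z - k x) / (z - x)))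
        \<longlongrightarrow> g x * k' x / k' x) (at x)"
      using k[of x] gk[of x] simple[OF True] unfolding has_field_derivative_iff
      by (intro tendsto_divide) auto
    have "\<forall>\<^sub>F z in at x. z \<notin> {x. k x = 0}"
      using fin by (metis islimpt_finite islimpt_iff_eventually mem_Collect_eq)
    then have "\<forall>\<^sub>F z in at x. ((g z * k z - g x * k x) / (z - x)) / ((k z - k x) / (z - x)) = g z"
      using eventually_neq_at_within[of x x UNIV]
      by eventually_elim (use True in auto)
    with quot have "(g \<longlongrightarrow> g x * k' x / k' x) (at x)"
      by (rule Lim_transform_eventually)
    then show ?thesis using simple[OF True] by (simp add: isCont_def)
  qed (use zero DERIV_isCont in blast)
  then have "continuous_on UNIV g" by (simp add: continuous_on_eq_continuous_at)
  \<comment> \<open>A continuous function on the plane with zero derivative off a finite set is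
    constant.\<close>
  then obtain c where "\<And>x. x \<in> UNIV \<Longrightarrow> g x = c"
    using fin zero DERIV_zero_connected_constant[of UNIV "{x. k x = 0}" g] by auto
  then show ?thesis by blast
qed

text \<open>As \<open>\<gamma> m \<noteq> 0\<close>, the relation at \<open>m\<close> determines the
  value at \<open>m + 1\<close> linearly and homogeneously from earlier ones. At fixed
  \<open>x\<close>, solutions are therefore multiples of each other; the factor may still depend on
  \<open>x\<close>.\<close>

lemma mult_rel_proportional:
  assumes \<gamma>: "\<And>n. \<gamma> n \<noteq> 0"
    and f: "\<And>n. mult_rel d \<gamma> \<alpha> f n" and \<psi>: "\<And>n. mult_rel d \<gamma> \<alpha> \<psi> n" and "\<psi> 0 x \<noteq> 0"
  shows "f n x = f 0 x / \<psi> 0 x * \<psi> n x"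
proof (induction n rule: less_induct)
  case (less n)
  show ?case
  proof (cases n)
    case 0
    then show ?thesis using \<open>\<psi> 0 x \<noteq> 0\<close> by simp
  next
    case (Suc m)
    let ?g = "f 0 x / \<psi> 0 x"
    have step: "\<gamma> m * F n x = x * F m x - (\<Sum>j | j \<le> d \<and> j \<le> m. \<alpha> j m * F (m - j) x)"
      if "mult_rel d \<gamma> \<alpha> F m" for F
      using that Suc by (simp add: mult_rel_def)
    have "(\<Sum>j | j \<le> d \<and> j \<le> m. \<alpha> j m * f (m - j) x)
        = ?g * (\<Sum>j | j \<le> d \<and> j \<le> m. \<alpha> j m * \<psi> (m - j) x)"
      unfolding sum_distrib_left
    proof (intro sum.cong refl)
      fix j
      have "f (m - j) x = ?g * \<psi> (m - j) x" by (intro less.IH) (simp add: Suc)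
      then show "\<alpha> j m * f (m - j) x = ?g * (\<alpha> j m * \<psi> (m - j) x)"
        by (simp only: mult.left_commute)
    qed
    moreover have "f m x = ?g * \<psi> m x" by (intro less.IH) (simp add: Suc)
    ultimately have "\<gamma> m * f n x = x * (?g * \<psi> m x)
        - ?g * (\<Sum>j | j \<le> d \<and> j \<le> m. \<alpha> j m * \<psi> (m - j) x)"
      using step[OF f[of m]] by simp
    also have "\<dots> = ?g * (\<gamma> m * \<psi> n x)"
      unfolding step[OF \<psi>[of m]] by (simp only: right_diff_distrib mult.left_commute)
    finally have "\<gamma> m * f n x = \<gamma> m * (?g * \<psi> n x)" by (simp only: mult.left_commute)
    then show ?thesis using \<gamma>[of m] by (simp only: mult_cancel_left) simp
  qed
qed

text \<open>The single relation at 1 already forces \<open>f\<close> to be a constant multiple of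
  \<psi>; all others then follow by linearity.\<close>

lemma deriv_rel_extend_to_0:
  assumes \<gamma>: "\<And>n. \<gamma> n \<noteq> 0"
    and f: "\<And>n. mult_rel d \<gamma> \<alpha> f n" and \<psi>: "\<And>n. mult_rel d \<gamma> \<alpha> \<psi> n"
    and \<psi>0: "\<And>x. \<psi> 0 x \<noteq> 0"
    and d\<psi>: "\<And>n. deriv_rel e \<gamma> \<beta> \<psi> n" and df: "deriv_rel e \<gamma> \<beta> f 1"
  shows "deriv_rel e \<gamma> \<beta> f n"
proof -
  define g where "g x = f 0 x / \<psi> 0 x" for x
  have fg: "f n x = g x * \<psi> n x" for n x
    unfolding g_def by (rule mult_rel_proportional[where \<gamma> = \<gamma> and \<alpha> = \<alpha>, OF \<gamma> f \<psi> \<psi>0])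
  define rhs where "rhs F n x = - (if n = 0 then 0 else \<gamma> (n - 1) * F (n - 1) x)
      - (\<Sum>j = 0..e. \<beta> j (n + j) * F (n + j) x)" for F :: "nat \<Rightarrow> complex \<Rightarrow> complex" and n x
  have rhs_f: "rhs f n x = g x * rhs \<psi> n x" for n x
    by (simp add: rhs_def fg right_diff_distrib sum_distrib_left mult.left_commute)
  have D\<psi>: "(\<psi> n has_field_derivative rhs \<psi> n x) (at x)" for n x
    using d\<psi>[of n] unfolding deriv_rel_def rhs_def by blast
  \<comment> \<open>The multiplication relation at 0 has one term in its sum, so
    \<open>\<psi> 1\<close> is a linear factor times the zero-free \<open>\<psi> 0\<close>. Its only
    zero is \<open>\<alpha> 0 0\<close>, and it is simple.\<close>
  have \<psi>1: "\<psi> 1 x = (x - \<alpha> 0 0) * \<psi> 0 x / \<gamma> 0" for x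
  proof -
    have "{j. j \<le> d \<and> j \<le> 0} = {0::nat}" by auto
    then show ?thesis using \<psi>[of 0] \<gamma>[of 0] by (simp add: mult_rel_def field_simps)
  qed
  have "\<exists>c. \<forall>x. g x = c"
  proof (rule constant_factor)
    show "(\<psi> 1 has_field_derivative rhs \<psi> 1 x) (at x)" for x by (rule D\<psi>)
    show "((\<lambda>x. g x * \<psi> 1 x) has_field_derivative g x * rhs \<psi> 1 x) (at x)" for x
      using df rhs_f[of 1 x] unfolding deriv_rel_def rhs_def fg[symmetric] by metis
    have zeros: "\<psi> 1 x = 0 \<longleftrightarrow> x = \<alpha> 0 0" for x
      using \<psi>1 \<psi>0 \<gamma>[of 0] by simp
    then show "finite {x. \<psi> 1 x = 0}" by simp
    show "rhs \<psi> 1 x \<noteq> 0" if "\<psi> 1 x = 0" for x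
    proof -
      have x: "x = \<alpha> 0 0" using that zeros by simp
      \<comment> \<open>In the product rule the term with the derivative of \<open>\<psi> 0\<close>
        vanishes at this point.\<close>
      have "((\<lambda>x. (x - \<alpha> 0 0) * \<psi> 0 x / \<gamma> 0) has_field_derivative \<psi> 0 x / \<gamma> 0) (at x)"
        using x \<gamma>[of 0] by (auto intro!: derivative_eq_intros D\<psi>)
      then have "(\<psi> 1 has_field_derivative \<psi> 0 x / \<gamma> 0) (at x)"
        by (simp flip: \<psi>1)
      then have "rhs \<psi> 1 x = \<psi> 0 x / \<gamma> 0" by (rule DERIV_unique[OF D\<psi>])
      then show ?thesis using \<psi>0 \<gamma>[of 0] by simp
    qed
  qed
  then obtain c where c: "g x = c" for x by blast
  have "(f n has_field_derivative rhs f n x) (at x)" for x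
  proof -
    have "((\<lambda>x. c * \<psi> n x) has_field_derivative c * rhs \<psi> n x) (at x)"
      by (intro DERIV_cmult D\<psi>)
    moreover have "f n = (\<lambda>x. c * \<psi> n x)" by (simp add: fun_eq_iff fg c)
    ultimately show ?thesis by (simp add: rhs_f c)
  qed
  then show ?thesis unfolding deriv_rel_def rhs_def by blast
qed

text \<open>The systems supply the relations with \<open>n \<ge> 1\<close>; comparison with the
  reference solution \<psi> adds \<open>n = 0\<close>. Here \<open>f\<close> satisfies
  \<open>mult_rel\<close> at every index, including those below \<open>d\<close>, so that it is
  determined by \<open>f 0\<close>.\<close>

lemma diff_system_iff_deriv_rel:
  assumes "\<And>n. \<gamma> n \<noteq> 0" "\<forall>n\<ge>d. \<alpha> d n \<noteq> 0" "d \<ge> 1"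
    and "\<And>n. mult_rel d \<gamma> \<alpha> f n" "\<And>n. mult_rel d \<gamma> \<alpha> \<psi> n" "\<And>x. \<psi> 0 x \<noteq> 0"
    and "\<And>n. deriv_rel e \<gamma> \<beta> \<psi> n"
  shows "(\<forall>N \<ge> d + 1. diff_system d (Dmat d e \<gamma> \<alpha> \<beta>) f N) \<longleftrightarrow> (\<forall>n. deriv_rel e \<gamma> \<beta> f n)"
  using diff_system_all_iff[where \<gamma> = \<gamma> and \<alpha> = \<alpha>, OF assms(1-3)
      window_rec_of_mult_rel[where \<gamma> = \<gamma> and \<alpha> = \<alpha>, OF assms(1,4)]]
    deriv_rel_extend_to_0[where \<gamma> = \<gamma> and \<alpha> = \<alpha>, OF assms(1,4-7)]
  by blast

section \<open>Systems and equivalences for both families\<close>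

theorem lemma2p4:
  fixes d1 d2 :: nat
    and u v :: "nat \<Rightarrow> complex"
    and \<Gamma>x \<Gamma>y :: contour
    and p q :: "nat \<Rightarrow> complex poly"
    and h r :: "nat \<Rightarrow> complex"
    and \<alpha> \<beta> :: "nat \<Rightarrow> nat \<Rightarrow> complex"
    and V1 V2 :: "complex \<Rightarrow> complex"
    and \<psi> \<phi> :: "nat \<Rightarrow> complex \<Rightarrow> complex"
    and \<gamma> :: "nat \<Rightarrow> complex"
    and a b D1 D2 :: "nat \<Rightarrow> complex \<Rightarrow> complex Matrix.mat"
  assumes "V1 = potential d1 u"
    and "V2 = potential d2 v"
    and "\<psi> = quasi_poly V1 p r"
    and "\<phi> = quasi_poly V2 q r"
    and "\<And>n. \<gamma> n = r (n + 1) / r n"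
    and "a = ladder d2 \<gamma> \<alpha>"
    and "b = ladder d1 \<gamma> \<beta>"
    and "D1 = Dmat d2 d1 \<gamma> \<alpha> \<beta>"
    and "D2 = Dmat d1 d2 \<gamma> \<beta> \<alpha>"
    and "d1 \<ge> 1" and "d2 \<ge> 1"
    and "u (d1 + 1) \<noteq> 0" and "v (d2 + 1) \<noteq> 0"
    and "valid_contour \<Gamma>x" and "valid_contour \<Gamma>y"
    and "weight_converges \<Gamma>x \<Gamma>y V1 V2"
    and "no_boundary_terms \<Gamma>x \<Gamma>y V1 V2"
    and "monic_seq p" and "monic_seq q"
    and "biorthogonal \<Gamma>x \<Gamma>y V1 V2 p q h"
    and "\<And>n. h n \<noteq> 0"
    and "\<And>n. (r n)\<^sup>2 = h n"
    and "recursion_coeffs d1 d2 \<gamma> \<psi> \<phi> \<alpha> \<beta>"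
  shows
    "(\<forall>N \<ge> d2. \<forall>x. invertible_mat (a N x)) \<and>
     (\<forall>N \<ge> d1. \<forall>y. invertible_mat (b N y)) \<and>
     (\<forall>N \<ge> d2 + 1. polynomial_mat (d2 + 1) (D1 N)) \<and>
     (\<forall>N \<ge> d1 + 1. polynomial_mat (d1 + 1) (D2 N)) \<and>
     window_rec d2 \<gamma> \<alpha> \<psi> \<and> window_rec d1 \<gamma> \<beta> \<phi> \<and>
     (\<forall>N \<ge> d2 + 1. diff_system d2 D1 \<psi> N) \<and>
     (\<forall>N \<ge> d1 + 1. diff_system d1 D2 \<phi> N) \<and>
     (\<forall>f. window_rec d2 \<gamma> \<alpha> f \<longrightarrow>
        (\<forall>N \<ge> d2. \<forall>j x. window d2 f (N + j) x = ladder_prod d2 \<gamma> \<alpha> N x j *\<^sub>v window d2 f N x) \<and>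
        ((\<forall>N \<ge> d2 + 1. diff_system d2 D1 f N) \<longleftrightarrow> (\<forall>n \<ge> 1. deriv_rel d1 \<gamma> \<beta> f n))) \<and>
     (\<forall>g. window_rec d1 \<gamma> \<beta> g \<longrightarrow>
        (\<forall>N \<ge> d1. \<forall>j y. window d1 g (N + j) y = ladder_prod d1 \<gamma> \<beta> N y j *\<^sub>v window d1 g N y) \<and>
        ((\<forall>N \<ge> d1 + 1. diff_system d1 D2 g N) \<longleftrightarrow> (\<forall>n \<ge> 1. deriv_rel d2 \<gamma> \<alpha> g n))) \<and>
     (\<forall>f. (\<forall>n. mult_rel d2 \<gamma> \<alpha> f n) \<longrightarrow>
        ((\<forall>N \<ge> d2 + 1. diff_system d2 D1 f N) \<longleftrightarrow> (\<forall>n. deriv_rel d1 \<gamma> \<beta> f n))) \<and>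
     (\<forall>g. (\<forall>n. mult_rel d1 \<gamma> \<beta> g n) \<longrightarrow>
        ((\<forall>N \<ge> d1 + 1. diff_system d1 D2 g N) \<longleftrightarrow> (\<forall>n. deriv_rel d2 \<gamma> \<alpha> g n)))"
proof -
  have r: "r n \<noteq> 0" for n
    using assms(21)[of n] assms(22)[of n] by auto
  have \<gamma>: "\<gamma> n \<noteq> 0" for n
    using r by (simp add: assms(5))
  have coeffs: "\<And>n. mult_rel d2 \<gamma> \<alpha> \<psi> n" "\<And>n. deriv_rel d1 \<gamma> \<beta> \<psi> n"
      "\<And>n. mult_rel d1 \<gamma> \<beta> \<phi> n" "\<And>n. deriv_rel d2 \<gamma> \<alpha> \<phi> n"
    using assms(23) by (auto simp: recursion_coeffs_def)
  \<comment> \<open>The families cross over: the relations of \<psi> give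
    \<open>\<beta> d1 n \<noteq> 0\<close>, which inverts the ladder of \<phi>, and those of \<phi>
    give \<open>\<alpha> d2 n \<noteq> 0\<close>, which inverts the ladder of \<psi>.\<close>
  have \<beta>: "\<forall>n\<ge>d1. \<beta> d1 n \<noteq> 0"
    using leading_coeff_nonzero[of r p d1 u \<gamma> \<beta>] r assms coeffs(2) by blast
  have \<alpha>: "\<forall>n\<ge>d2. \<alpha> d2 n \<noteq> 0"
    using leading_coeff_nonzero[of r q d2 v \<gamma> \<alpha>] r assms coeffs(4) by blast
  \<comment> \<open>A monic polynomial of degree 0 is 1, so \<open>\<psi> 0\<close> and
    \<open>\<phi> 0\<close> are nonzero multiples of exponentials and have no zeros.\<close>
  have p0: "poly (P 0) x = 1" if "monic_seq P" for P :: "nat \<Rightarrow> complex poly" and x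
  proof -
    have deg: "degree (P 0) = 0" and lc: "lead_coeff (P 0) = 1"
      using that unfolding monic_seq_def by blast+
    from deg obtain c where "P 0 = [:c:]" by (rule degree_eq_zeroE)
    with lc show ?thesis by simp
  qed
  have \<psi>0: "\<psi> 0 x \<noteq> 0" and \<phi>0: "\<phi> 0 x \<noteq> 0" for x
    using r p0 assms by (simp_all add: quasi_poly_def)
  have rec: "window_rec d2 \<gamma> \<alpha> \<psi>" "window_rec d1 \<gamma> \<beta> \<phi>"
    by (intro window_rec_of_mult_rel \<gamma> coeffs)+
  note side1 = \<gamma> \<alpha> \<open>d2 \<ge> 1\<close>
  note side2 = \<gamma> \<beta> \<open>d1 \<ge> 1\<close>
  \<comment> \<open>The premise left open is the multiplication recursion of the compared sequence;
    \<psi> itself is the reference solution.\<close>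
  note iff1 =
    diff_system_iff_deriv_rel[where \<gamma> = \<gamma> and \<alpha> = \<alpha>, OF side1 _ coeffs(1) \<psi>0 coeffs(2)]
  note iff2 =
    diff_system_iff_deriv_rel[where \<gamma> = \<gamma> and \<alpha> = \<beta>, OF side2 _ coeffs(3) \<phi>0 coeffs(4)]
  show ?thesis
    unfolding \<open>a = _\<close> \<open>b = _\<close> \<open>D1 = _\<close> \<open>D2 = _\<close>
  proof (intro conjI)
    show "\<forall>N \<ge> d2. \<forall>x. invertible_mat (ladder d2 \<gamma> \<alpha> N x)"
      using invertible_ladder side1 by blast
    show "\<forall>N \<ge> d1. \<forall>y. invertible_mat (ladder d1 \<gamma> \<beta> N y)"
      using invertible_ladder side2 by blast
    show "\<forall>N \<ge> d2 + 1. polynomial_mat (d2 + 1) (Dmat d2 d1 \<gamma> \<alpha> \<beta> N)"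
      using polynomial_mat_Dmat[where \<gamma> = \<gamma> and \<alpha> = \<alpha>, OF side1] by blast
    show "\<forall>N \<ge> d1 + 1. polynomial_mat (d1 + 1) (Dmat d1 d2 \<gamma> \<beta> \<alpha> N)"
      using polynomial_mat_Dmat[where \<gamma> = \<gamma> and \<alpha> = \<beta>, OF side2] by blast
    show "\<forall>N \<ge> d2 + 1. diff_system d2 (Dmat d2 d1 \<gamma> \<alpha> \<beta>) \<psi> N"
      using iff1[OF coeffs(1)] coeffs(2) by blast
    show "\<forall>N \<ge> d1 + 1. diff_system d1 (Dmat d1 d2 \<gamma> \<beta> \<alpha>) \<phi> N"
      using iff2[OF coeffs(3)] coeffs(4) by blast
    show "\<forall>f. window_rec d2 \<gamma> \<alpha> f \<longrightarrow>
        (\<forall>N \<ge> d2. \<forall>j x. window d2 f (N + j) x = ladder_prod d2 \<gamma> \<alpha> N x j *\<^sub>v window d2 f N x) \<and>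
        ((\<forall>N \<ge> d2 + 1. diff_system d2 (Dmat d2 d1 \<gamma> \<alpha> \<beta>) f N)
          \<longleftrightarrow> (\<forall>n \<ge> 1. deriv_rel d1 \<gamma> \<beta> f n))"
      by (intro allI impI conjI window_ladder_prod
          diff_system_all_iff[where \<gamma> = \<gamma> and \<alpha> = \<alpha>, OF side1])
    show "\<forall>g. window_rec d1 \<gamma> \<beta> g \<longrightarrow>
        (\<forall>N \<ge> d1. \<forall>j y. window d1 g (N + j) y = ladder_prod d1 \<gamma> \<beta> N y j *\<^sub>v window d1 g N y) \<and>
        ((\<forall>N \<ge> d1 + 1. diff_system d1 (Dmat d1 d2 \<gamma> \<beta> \<alpha>) g N)
          \<longleftrightarrow> (\<forall>n \<ge> 1. deriv_rel d2 \<gamma> \<alpha> g n))"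
      by (intro allI impI conjI window_ladder_prod
          diff_system_all_iff[where \<gamma> = \<gamma> and \<alpha> = \<beta>, OF side2])
    show "\<forall>f. (\<forall>n. mult_rel d2 \<gamma> \<alpha> f n) \<longrightarrow>
        ((\<forall>N \<ge> d2 + 1. diff_system d2 (Dmat d2 d1 \<gamma> \<alpha> \<beta>) f N) \<longleftrightarrow> (\<forall>n. deriv_rel d1 \<gamma> \<beta> f n))"
      by (intro allI impI iff1) blast
    show "\<forall>g. (\<forall>n. mult_rel d1 \<gamma> \<beta> g n) \<longrightarrow>
        ((\<forall>N \<ge> d1 + 1. diff_system d1 (Dmat d1 d2 \<gamma> \<beta> \<alpha>) g N) \<longleftrightarrow> (\<forall>n. deriv_rel d2 \<gamma> \<alpha> g n))"
      by (intro allI impI iff2) blast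
  qed (fact rec)+
qed

end
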